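(* Let $G$ be an edge-colored graph on $n$ vertices. If $\sum_{v\in V(G)}d^c(v)\geq n(n+1)/2$, then $G$ contains a rainbow triangle.
   Context: All graphs are simple and finite, with at least one vertex. An edge-colored graph is a graph $G=(V,E)$ together with an arbitrary mapping $C:E\to\mathbb{N}$ (not required to be a proper edge-coloring). For a vertex $v$ of $G$, the color degree $d^c(v)$ is the number of distinct colors appearing on the edges incident to $v$. A rainbow triangle is a triangle of $G$ whose three edges have pairwise distinct colors. *)

theory Defs
  imports Complex_Main
begin

definition simple_graph :: "'a set \<Rightarrow> 'a set set \<Rightarrow> bool" where
  "simple_graph V E \<longleftrightarrow> finite V \<and> V \<noteq> {} \<and> (\<forall>e\<in>E. e \<subseteq> V \<and> card e = 2)"

(* An edge colouring is a total function on vertex sets; only its values on E matter. *)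

definition color_degree :: "'a set set \<Rightarrow> ('a set \<Rightarrow> nat) \<Rightarrow> 'a \<Rightarrow> nat" where
  "color_degree E C v = card (C ` {e \<in> E. v \<in> e})"

definition triangle :: "'a set set \<Rightarrow> 'a \<Rightarrow> 'a \<Rightarrow> 'a \<Rightarrow> bool" where
  "triangle E u v w \<longleftrightarrow>
     u \<noteq> v \<and> v \<noteq> w \<and> u \<noteq> w \<and> {u, v} \<in> E \<and> {v, w} \<in> E \<and> {u, w} \<in> E"

definition rainbow_triangle ::
    "'a set set \<Rightarrow> ('a set \<Rightarrow> nat) \<Rightarrow> 'a \<Rightarrow> 'a \<Rightarrow> 'a \<Rightarrow> bool" where
  "rainbow_triangle E C u v w \<longleftrightarrow>
     triangle E u v w \<and>
     C {u, v} \<noteq> C {v, w} \<and> C {v, w} \<noteq> C {u, w} \<and> C {u, v} \<noteq> C {u, w}"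

end

theory Submission
  imports Defs
begin

text \<open>Induction on the number of vertices, deleting a vertex \<open>v\<close> of minimum degree. Let \<open>T\<close> be the
set of neighbours \<open>u\<close> of \<open>v\<close> that lose a colour with \<open>v\<close>, and let \<open>s\<close> be the number of colours on
the edges between \<open>v\<close> and \<open>T\<close>. The deletion lowers the colour degree sum by \<open>d\<^sup>c(v) + |T| \<le> d(v) + s\<close>.
Without rainbow triangles, vertices of \<open>T\<close> joined to \<open>v\<close> in different colours are non-adjacent: the
colour of an edge between them would have to recur at one of its ends. So if \<open>T\<close> contains some
\<open>u\<close>, then \<open>u\<close> misses \<open>s\<close> vertices (itself included) and \<open>d(v) \<le> d(u) \<le> n - s\<close>. The sum
therefore drops by at most \<open>n\<close>.\<close>

definition nbrs :: "'a set set \<Rightarrow> 'a \<Rightarrow> 'a set" where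
  "nbrs E v = {u. {v, u} \<in> E}"

definition lossy_nbrs :: "'a set set \<Rightarrow> ('a set \<Rightarrow> nat) \<Rightarrow> 'a \<Rightarrow> 'a set" where
  "lossy_nbrs E C v =
     {u \<in> nbrs E v. \<forall>e\<in>E. u \<in> e \<and> C e = C {v, u} \<longrightarrow> e = {v, u}}"

lemma simple_graphD:
  assumes "simple_graph V E"
  shows "finite V" "V \<noteq> {}" "finite E" "\<And>e. e \<in> E \<Longrightarrow> e \<subseteq> V" "\<And>e. e \<in> E \<Longrightarrow> card e = 2"
proof -
  show "finite V" "V \<noteq> {}" "\<And>e. e \<in> E \<Longrightarrow> e \<subseteq> V" "\<And>e. e \<in> E \<Longrightarrow> card e = 2"
    using assms by (auto simp: simple_graph_def)
  then show "finite E"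
    using finite_subset[of E "Pow V"] by auto
qed

lemma nbrs_subset:
  assumes "simple_graph V E"
  shows "nbrs E v \<subseteq> V - {v}"
proof
  fix u assume "u \<in> nbrs E v"
  then have e: "{v, u} \<in> E" by (simp add: nbrs_def)
  have "u \<noteq> v" using simple_graphD(5)[OF assms e] by auto
  then show "u \<in> V - {v}" using simple_graphD(4)[OF assms e] by simp
qed

lemma simple_graph_edges_at:
  assumes "simple_graph V E"
  shows "{e \<in> E. v \<in> e} = (\<lambda>u. {v, u}) ` nbrs E v"
proof
  show "{e \<in> E. v \<in> e} \<subseteq> (\<lambda>u. {v, u}) ` nbrs E v"
  proof
    fix e assume e: "e \<in> {e \<in> E. v \<in> e}"
    then have "card e = 2" using simple_graphD(5)[OF assms] by blast
    with e obtain u where "e = {v, u}" by (auto simp: card_2_iff)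
    with e show "e \<in> (\<lambda>u. {v, u}) ` nbrs E v" by (auto simp: nbrs_def)
  qed
qed (auto simp: nbrs_def)

lemma simple_graph_delete_vertex:
  assumes "simple_graph V E" "V - {v} \<noteq> {}"
  shows "simple_graph (V - {v}) {e \<in> E. v \<notin> e}"
  using assms by (auto simp: simple_graph_def)

text \<open>The only edge at \<open>u\<close> that disappears is \<open>{v, u}\<close>, if it
  exists, so at most its colour is lost. If \<open>u\<close> is not lossy, another edge at
  \<open>u\<close> carries that colour, and it survives.\<close>

lemma color_degree_delete_vertex:
  assumes G: "simple_graph V E" and "u \<noteq> v"
  shows "color_degree E C u
    \<le> color_degree {e \<in> E. v \<notin> e} C u + (if u \<in> lossy_nbrs E C v then 1 else 0)"
proof -
  let ?A = "C ` {e \<in> E. u \<in> e}" and ?B = "C ` {e \<in> {e \<in> E. v \<notin> e}. u \<in> e}"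
  have fin: "finite ?B" using simple_graphD(3)[OF G] by simp
  have only: "e = {v, u}" if "e \<in> E" "u \<in> e" "v \<in> e" for e
    using that \<open>u \<noteq> v\<close> simple_graphD(5)[OF G that(1)] by (auto simp: card_2_iff)
  show ?thesis
  proof (cases "u \<in> lossy_nbrs E C v")
    case True
    have "?A \<subseteq> insert (C {v, u}) ?B" using only by blast
    then have "card ?A \<le> card (insert (C {v, u}) ?B)" using fin by (intro card_mono) auto
    also have "\<dots> \<le> card ?B + 1" using fin by (simp add: card_insert_if)
    finally show ?thesis using True by (simp add: color_degree_def)
  next
    case False
    have "?A \<subseteq> ?B"
    proof (rule image_subsetI)
      fix e assume e: "e \<in> {e \<in> E. u \<in> e}"
      show "C e \<in> ?B"
      proof (cases "v \<in> e")
        case True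
        then have "e = {v, u}" using only e by blast
        \<comment> \<open>Such an \<open>f\<close> avoids \<open>v\<close>: by \<open>only\<close>,
          an edge through both \<open>u\<close> and \<open>v\<close> is \<open>{v, u}\<close>
          itself.\<close>
        moreover from this obtain f where "f \<in> E" "u \<in> f" "C f = C {v, u}" "f \<noteq> {v, u}"
          using False e by (auto simp: lossy_nbrs_def nbrs_def)
        ultimately show ?thesis using only by (metis (mono_tags, lifting) image_eqI mem_Collect_eq)
      qed (use e in blast)
    qed
    then have "card ?A \<le> card ?B" using fin by (rule card_mono[rotated])
    then show ?thesis using False by (simp add: color_degree_def)
  qed
qed

text \<open>Split the colours at \<open>v\<close>: those on edges to lossy neighbours are counted
  exactly, and the remaining neighbours contribute at most one colour each.\<close>

lemma color_degree_lossy_le: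
  assumes G: "simple_graph V E"
  shows "color_degree E C v + card (lossy_nbrs E C v)
    \<le> card (nbrs E v) + card ((\<lambda>u. C {v, u}) ` lossy_nbrs E C v)"
proof -
  let ?N = "nbrs E v" and ?T = "lossy_nbrs E C v" and ?c = "\<lambda>u. C {v, u}"
  have finN: "finite ?N" using nbrs_subset[OF G] simple_graphD(1)[OF G] finite_subset by blast
  have TN: "?T \<subseteq> ?N" by (auto simp: lossy_nbrs_def)
  have "color_degree E C v = card (?c ` ?N)"
    by (simp add: color_degree_def simple_graph_edges_at[OF G] image_image)
  also have "?c ` ?N = ?c ` (?N - ?T) \<union> ?c ` ?T" using TN by blast
  also have "card \<dots> \<le> card (?c ` (?N - ?T)) + card (?c ` ?T)" by (rule card_Un_le)
  also have "card (?c ` (?N - ?T)) \<le> card (?N - ?T)" using finN by (intro card_image_le) simp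
  also have "\<dots> = card ?N - card ?T" using TN finN by (intro card_Diff_subset) (auto intro: finite_subset)
  finally show ?thesis using card_mono[OF finN TN] by linarith
qed

lemma lossy_nbrs_not_adjacent:
  assumes nr: "\<not> (\<exists>u\<in>V. \<exists>v\<in>V. \<exists>w\<in>V. rainbow_triangle E C u v w)"
    and G: "simple_graph V E"
    and x: "x \<in> lossy_nbrs E C v" and y: "y \<in> lossy_nbrs E C v"
    and ne: "C {v, x} \<noteq> C {v, y}"
  shows "{x, y} \<notin> E"
proof
  assume xy: "{x, y} \<in> E"
  have vx: "{v, x} \<in> E" and vy: "{v, y} \<in> E" using x y by (auto simp: lossy_nbrs_def nbrs_def)
  have dist: "v \<noteq> x" "v \<noteq> y" "x \<noteq> y"
    using vx vy nbrs_subset[OF G] ne by (auto simp: nbrs_def)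
  then have neq: "{x, y} \<noteq> {v, x}" "{x, y} \<noteq> {v, y}" by (auto simp: doubleton_eq_iff)
  \<comment> \<open>At \<open>x\<close>, only \<open>{v, x}\<close> has its colour, because
    \<open>x\<close> is lossy; likewise at \<open>y\<close> below.\<close>
  have "C {x, y} \<noteq> C {v, x}" using x xy neq by (auto simp: lossy_nbrs_def)
  moreover have "C {x, y} \<noteq> C {v, y}" using y xy neq by (auto simp: lossy_nbrs_def)
  ultimately have "rainbow_triangle E C v x y"
    using ne dist vx vy xy by (auto simp: rainbow_triangle_def triangle_def)
  moreover have "v \<in> V" "x \<in> V" "y \<in> V" using vx vy simple_graphD(4)[OF G] by blast+
  ultimately show False using nr by blast
qed

text \<open>Choose one lossy neighbour of \<open>v\<close> per colour, with \<open>u\<close>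
  representing its own. None of these is adjacent to \<open>u\<close>, so they and the neighbours of
  \<open>u\<close> are disjoint subsets of \<open>V\<close>.\<close>

lemma degree_lossy_nbr_le:
  assumes nr: "\<not> (\<exists>u\<in>V. \<exists>v\<in>V. \<exists>w\<in>V. rainbow_triangle E C u v w)"
    and G: "simple_graph V E" and u: "u \<in> lossy_nbrs E C v"
  shows "card (nbrs E u) + card ((\<lambda>x. C {v, x}) ` lossy_nbrs E C v) \<le> card V"
proof -
  let ?T = "lossy_nbrs E C v" and ?c = "\<lambda>x. C {v, x}"
  \<comment> \<open>The colour of \<open>u\<close> is left out so that \<open>u\<close> itself can
    represent it; \<open>R\<close> then picks one vertex for each other colour.\<close>
  define A where "A = {x \<in> ?T. ?c x \<noteq> ?c u}"
  obtain R where R: "R \<subseteq> A" "inj_on ?c R" "?c ` A = ?c ` R"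
    using subset_image_inj[of "?c ` A" ?c A] by auto
  have finV: "finite V" using simple_graphD(1)[OF G] .
  have TV: "?T \<subseteq> V" using nbrs_subset[OF G, of v] by (auto simp: lossy_nbrs_def)
  have RT: "R \<subseteq> ?T" using R(1) by (auto simp: A_def)
  then have finR: "finite R" using TV finV by (meson finite_subset)
  have "?c ` ?T = insert (?c u) (?c ` A)" using u by (auto simp: A_def)
  then have "?c ` ?T = ?c ` insert u R" using R(3) by simp
  moreover have "inj_on ?c (insert u R)" using R(1,2) by (auto simp: A_def)
  ultimately have card: "card (?c ` ?T) = card (insert u R)" by (metis card_image)
  have "w \<notin> insert u R" if w: "w \<in> nbrs E u" for w
  proof
    assume "w \<in> insert u R"
    moreover have "w \<noteq> u" using w nbrs_subset[OF G, of u] by blast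
    ultimately have "w \<in> A" using R(1) by blast
    then have "w \<in> ?T" "?c u \<noteq> ?c w" by (auto simp: A_def)
    then have "{u, w} \<notin> E" by (rule lossy_nbrs_not_adjacent[OF nr G u])
    then show False using w by (simp add: nbrs_def)
  qed
  then have "nbrs E u \<inter> insert u R = {}" by blast
  moreover have "finite (nbrs E u)" using nbrs_subset[OF G] finV finite_subset by blast
  ultimately have "card (nbrs E u) + card (insert u R) = card (nbrs E u \<union> insert u R)"
    using finR by (metis card_Un_disjoint finite_insert)
  also have "\<dots> \<le> card V"
    using nbrs_subset[OF G, of u] RT TV u by (intro card_mono finV) blast
  finally show ?thesis using card by simp
qed

lemma exists_cheap_vertex:
  assumes nr: "\<not> (\<exists>u\<in>V. \<exists>v\<in>V. \<exists>w\<in>V. rainbow_triangle E C u v w)"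
    and G: "simple_graph V E"
  shows "\<exists>v\<in>V. color_degree E C v + card (lossy_nbrs E C v) \<le> card V"
proof -
  define v where "v = arg_min_on (\<lambda>u. card (nbrs E u)) V"
  have v: "v \<in> V"
    unfolding v_def by (rule arg_min_if_finite(1)[OF simple_graphD(1,2)[OF G]])
  have min: "card (nbrs E v) \<le> card (nbrs E u)" if "u \<in> V" for u
    unfolding v_def by (rule arg_min_least[OF simple_graphD(1,2)[OF G] that])
  have "card (nbrs E v) + card ((\<lambda>x. C {v, x}) ` lossy_nbrs E C v) \<le> card V"
  \<comment> \<open>Without lossy neighbours the second summand is 0 and the trivial degree bound
    suffices. Otherwise minimality of the degree of \<open>v\<close> transfers the bound from a
    lossy neighbour \<open>u\<close>.\<close>
  proof (cases "lossy_nbrs E C v = {}")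
    case True
    then show ?thesis
      using nbrs_subset[OF G, of v] simple_graphD(1)[OF G] card_mono[of V "nbrs E v"] by auto
  next
    case False
    then obtain u where u: "u \<in> lossy_nbrs E C v" by blast
    then have "u \<in> V" using nbrs_subset[OF G, of v] by (auto simp: lossy_nbrs_def)
    then show ?thesis using min degree_lossy_nbr_le[OF nr G u] by fastforce
  qed
  then show ?thesis using v color_degree_lossy_le[OF G, of C v] by (meson le_trans)
qed

text \<open>The strictness comes from a single vertex, where the claim reads 0 < 2; hence the
  induction starts at one vertex. Doubling keeps the bound within the natural numbers.\<close>

lemma sum_color_degree_less:
  assumes "\<not> (\<exists>u\<in>V. \<exists>v\<in>V. \<exists>w\<in>V. rainbow_triangle E C u v w)"
    and "simple_graph V E" and "card V = Suc m"
  shows "2 * (\<Sum>v\<in>V. color_degree E C v) < Suc m * (Suc m + 1)"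
  using assms
proof (induction m arbitrary: V E)
  case 0
  then obtain v where V: "V = {v}" by (auto simp: card_1_singleton_iff)
  have "nbrs E v = {}" using nbrs_subset[OF "0.prems"(2), of v] V by auto
  then have "color_degree E C v = 0"
    by (simp add: color_degree_def simple_graph_edges_at[OF "0.prems"(2)])
  then show ?case using V by simp
next
  case (Suc m)
  note G = Suc.prems(2)
  have finV: "finite V" using simple_graphD(1)[OF G] .
  obtain v where v: "v \<in> V" and le: "color_degree E C v + card (lossy_nbrs E C v) \<le> card V"
    using exists_cheap_vertex[OF Suc.prems(1,2)] by blast
  let ?E = "{e \<in> E. v \<notin> e}" and ?T = "lossy_nbrs E C v"
  have cV: "card (V - {v}) = Suc m" using v Suc.prems(3) by simp
  then have "V - {v} \<noteq> {}" by force
  then have G': "simple_graph (V - {v}) ?E" by (rule simple_graph_delete_vertex[OF G])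
  have nr': "\<not> (\<exists>u\<in>V - {v}. \<exists>x\<in>V - {v}. \<exists>w\<in>V - {v}. rainbow_triangle ?E C u x w)"
    using Suc.prems(1) by (auto simp: rainbow_triangle_def triangle_def)
  have TV: "?T \<subseteq> V - {v}" using nbrs_subset[OF G, of v] by (auto simp: lossy_nbrs_def)
  have "(\<Sum>u\<in>V. color_degree E C u) = color_degree E C v + (\<Sum>u\<in>V - {v}. color_degree E C u)"
    using finV v by (rule sum.remove)
  also have "(\<Sum>u\<in>V - {v}. color_degree E C u)
      \<le> (\<Sum>u\<in>V - {v}. color_degree ?E C u + (if u \<in> ?T then 1 else 0))"
    by (rule sum_mono, rule color_degree_delete_vertex[OF G]) auto
  also have "\<dots> = (\<Sum>u\<in>V - {v}. color_degree ?E C u) + (\<Sum>u\<in>V - {v}. if u \<in> ?T then 1 else 0)"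
    by (rule sum.distrib)
  also have "(\<Sum>u\<in>V - {v}. if u \<in> ?T then 1 else (0::nat)) = card ?T"
    using finV TV by (simp add: sum.If_cases Int_absorb1)
  finally have "(\<Sum>u\<in>V. color_degree E C u)
      \<le> (\<Sum>u\<in>V - {v}. color_degree ?E C u) + Suc (Suc m)"
    using le Suc.prems(3) by linarith
  \<comment> \<open>With k = \<open>card V\<close>, the doubled sum grows by at most 2k, which is
    exactly k(k + 1) - (k - 1)k.\<close>
  with Suc.IH[OF nr' G' cV] show ?case by (simp add: algebra_simps)
qed

theorem theorem2:
  fixes V :: "'a set" and E :: "'a set set" and C :: "'a set \<Rightarrow> nat" and n :: nat
  assumes "simple_graph V E"
    and "card V = n"
    and "real (\<Sum>v\<in>V. color_degree E C v) \<ge> real n * (real n + 1) / 2"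
  shows "\<exists>u\<in>V. \<exists>v\<in>V. \<exists>w\<in>V. rainbow_triangle E C u v w"
proof (rule ccontr)
  assume nr: "\<not> ?thesis"
  have "n \<noteq> 0" using assms(2) simple_graphD(1,2)[OF assms(1)] by auto
  then obtain m where m: "n = Suc m" by (cases n) auto
  have "2 * (\<Sum>v\<in>V. color_degree E C v) < n * (n + 1)"
    unfolding m by (rule sum_color_degree_less[OF nr assms(1)]) (use assms(2) m in simp)
  then have "real (2 * (\<Sum>v\<in>V. color_degree E C v)) < real (n * (n + 1))"
    by (simp only: of_nat_less_iff)
  moreover have "real (n * (n + 1)) = real n * (real n + 1)" by (simp add: distrib_left)
  ultimately show False using assms(3) by linarith
qed

end
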